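(* Let $F:\mathbb{R}^n\rightrightarrows\mathbb{R}^q$ be a polyhedral convex set-valued mapping, let $C\subseteq\mathbb{R}^q$ be a polyhedral convex cone with nonempty interior, and let $\bar y\in\mathcal{P}$, where $\mathcal{P}$ is the upper image of problem (P). Then the procedure $\mathtt{ComputeMinimizer}(F,C,\bar y)$, after finitely many steps, either returns a minimizer $\bar x$ of (P) with the property $\bar y\in F(\bar x)+C$, or returns the empty set. The number of iterations of its loop is bounded above by the minimal number of inequalities in an inequality representation of the graph of the mapping $F_C:\mathbb{R}^n\rightrightarrows\mathbb{R}^q$, $F_C(x)=F(x)+C$.
   Context: A set-valued mapping $F:\mathbb{R}^n\rightrightarrows\mathbb{R}^q$ is polyhedral convex if its graph $\mathrm{gr}\,F=\{(x,y)\in\mathbb{R}^n\times\mathbb{R}^q : y\in F(x)\}$ is a convex polyhedron; $\mathrm{dom}\,F=\{x : F(x)\ne\emptyset\}$. Polyhedral convex cones are nonempty (contain $0$). Problem (P) is: minimize $F(x)+C$ over $x\in\mathbb{R}^n$ with respect to the ordering $\supseteq$ ("$\supseteq$" is read "less than or equal to"). Its upper image is $\mathcal{P}=C+\bigcup_{x\in\mathbb{R}^n}F(x)$. A minimizer of (P) is a point $\bar x\in\mathrm{dom}\,F$ such that there is no $x\in\mathbb{R}^n$ with $F(x)+C\supsetneq F(\bar x)+C$. Minimal system of outer normals: for a polyhedral convex set $Q\subseteq\mathbb{R}^q$, the family $\{w^1,\dots,w^k\}$ of vectors arising from an inequality representation $Q=\{y : y^Tw^1\le\gamma_1,\dots,y^Tw^k\le\gamma_k\}$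 with $\|w^1\|=\dots=\|w^k\|=1$ and $k$ minimal. If $Q$ has nonempty interior, these are the uniquely determined unit outer normals at the facets of $Q$. For $\bar x\in\mathrm{dom}\,F$ and $w\in\mathbb{R}^q$, $\mathrm{LP}(F,w,\bar x)$ is the linear program: maximize $w^Ty$ over $(x,y)\in\mathbb{R}^n\times\mathbb{R}^q$ subject to $y\in F(x)+C$ and $F(\bar x)+C\subseteq F(x)+C$. Procedure $\mathtt{ComputeMinimizer}(F,C,\bar y)$: 1. Choose $\bar x\in\mathbb{R}^n$ with $\bar y\in F(\bar x)+C$. Let $N$ be the minimal system of outer normals of $F(\bar x)+C$, and let $W=\emptyset$. 2. While $N\not\subseteq W$: choose $w\in N\setminus W$ and replace $W$ by $W\cup\{w\}$. If $\mathrm{LP}(F,w,\bar x)$ has no optimal solution, return $\emptyset$ and stop; otherwise let $(x^*,y^* )$ be an optimal solution. If $y^*\notin F(\bar x)+C$, replace $\bar x$ by $x^*$ and replace $N$ by the minimal system of outer normals of the new set $F(\bar x)+C$. 3. Return $\{\bar x\}$. All choices in the procedure are arbitrary. *)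

theory Defs
  imports "HOL-Analysis.Analysis"
begin

text \<open>A set-valued mapping is a function into sets, and the Minkowski sum \<open>A + B\<close> is the
  sum of sets from \<open>Set_Algebras\<close>; in particular \<open>{} + C = {}\<close>.\<close>

definition gr :: "('a \<Rightarrow> 'b set) \<Rightarrow> ('a \<times> 'b) set" where
  "gr F = {(x, y). y \<in> F x}"

definition Dom :: "('a \<Rightarrow> 'b set) \<Rightarrow> 'a set" where
  "Dom F = {x. F x \<noteq> {}}"

definition polyhedral_convex_map ::
    "('a::euclidean_space \<Rightarrow> 'b::euclidean_space set) \<Rightarrow> bool" where
  "polyhedral_convex_map F \<longleftrightarrow> polyhedron (gr F)"

definition add_cone :: "('a \<Rightarrow> 'b::plus set) \<Rightarrow> 'b set \<Rightarrow> 'a \<Rightarrow> 'b set" where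
  "add_cone F C = (\<lambda>x. F x + C)"

definition upper_image :: "('a \<Rightarrow> 'b::plus set) \<Rightarrow> 'b set \<Rightarrow> 'b set" where
  "upper_image F C = C + (\<Union>x. F x)"

definition minimizer :: "('a \<Rightarrow> 'b::plus set) \<Rightarrow> 'b set \<Rightarrow> 'a \<Rightarrow> bool" where
  "minimizer F C xb \<longleftrightarrow> xb \<in> Dom F \<and> \<not> (\<exists>x. F x + C \<supset> F xb + C)"


definition ineq_rep :: "nat \<Rightarrow> (nat \<Rightarrow> 'a::real_inner) \<Rightarrow> (nat \<Rightarrow> real) \<Rightarrow> 'a set \<Rightarrow> bool" where
  "ineq_rep k w \<gamma> Q \<longleftrightarrow> Q = {y. \<forall>i<k. y \<bullet> w i \<le> \<gamma> i}"

text \<open>A predicate rather than a \<open>LEAST\<close>, so that asserting it includes the existence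
  of a representation.\<close>

definition min_ineq_number :: "'a::real_inner set \<Rightarrow> nat \<Rightarrow> bool" where
  "min_ineq_number Q m \<longleftrightarrow>
     (\<exists>w \<gamma>. ineq_rep m w \<gamma> Q) \<and> (\<forall>k w \<gamma>. ineq_rep k w \<gamma> Q \<longrightarrow> m \<le> k)"

definition unit_ineq_rep ::
    "nat \<Rightarrow> (nat \<Rightarrow> 'a::real_inner) \<Rightarrow> (nat \<Rightarrow> real) \<Rightarrow> 'a set \<Rightarrow> bool" where
  "unit_ineq_rep k w \<gamma> Q \<longleftrightarrow> ineq_rep k w \<gamma> Q \<and> (\<forall>i<k. norm (w i) = 1)"

definition minimal_outer_normals :: "'a::real_inner set \<Rightarrow> 'a set \<Rightarrow> bool" where
  "minimal_outer_normals Q N \<longleftrightarrow>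
     (\<exists>k w \<gamma>. unit_ineq_rep k w \<gamma> Q \<and> N = w ` {..<k} \<and>
        (\<forall>k' w' \<gamma>'. unit_ineq_rep k' w' \<gamma>' Q \<longrightarrow> k \<le> k'))"


definition LP_feasible ::
    "('a \<Rightarrow> 'b::real_inner set) \<Rightarrow> 'b set \<Rightarrow> 'a \<Rightarrow> ('a \<times> 'b) set" where
  "LP_feasible F C xb = {(x, y). y \<in> F x + C \<and> F xb + C \<subseteq> F x + C}"

definition LP_optimal ::
    "('a \<Rightarrow> 'b::real_inner set) \<Rightarrow> 'b set \<Rightarrow> 'b \<Rightarrow> 'a \<Rightarrow> 'a \<times> 'b \<Rightarrow> bool" where
  "LP_optimal F C w xb p \<longleftrightarrow>
     p \<in> LP_feasible F C xb \<and> (\<forall>p' \<in> LP_feasible F C xb. w \<bullet> snd p' \<le> w \<bullet> snd p)"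


text \<open>The procedure as a nondeterministic transition system, each transition realizing one
  of its arbitrary choices. \<open>Normals xb W\<close> is the point at which the minimal system of outer
  normals of \<open>F xb + C\<close> is about to be computed, and \<open>Loop xb N W\<close> the point at which the
  loop condition is about to be tested. Computing the normals is a transition of its own so
  that, were no such system to exist, the execution would be stuck rather than absent.\<close>

datatype ('a, 'b) config =
    Start
  | Normals 'a "'b set"
  | Loop 'a "'b set" "'b set"
  | Return "'a set"

text \<open>In \<open>step F C yb c j c'\<close> the label \<open>j\<close> is 1 if the transition enters the loop body and
  0 otherwise; an iteration that returns the empty set is thus counted as well.\<close>

inductive step :: "('a \<Rightarrow> 'b::real_inner set) \<Rightarrow> 'b set \<Rightarrow> 'b \<Rightarrow>
    ('a, 'b) config \<Rightarrow> nat \<Rightarrow> ('a, 'b) config \<Rightarrow> bool"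
  for F :: "'a \<Rightarrow> 'b set" and C :: "'b set" and yb :: 'b where
  choose_start: "yb \<in> F xb + C \<Longrightarrow> step F C yb Start 0 (Normals xb {})"
| compute_normals: "minimal_outer_normals (F xb + C) N \<Longrightarrow>
    step F C yb (Normals xb W) 0 (Loop xb N W)"
| no_optimum: "w \<in> N - W \<Longrightarrow> \<not> (\<exists>p. LP_optimal F C w xb p) \<Longrightarrow>
    step F C yb (Loop xb N W) 1 (Return {})"
| keep: "w \<in> N - W \<Longrightarrow> LP_optimal F C w xb (x, y) \<Longrightarrow> y \<in> F xb + C \<Longrightarrow>
    step F C yb (Loop xb N W) 1 (Loop xb N (insert w W))"
| replace: "w \<in> N - W \<Longrightarrow> LP_optimal F C w xb (x, y) \<Longrightarrow> y \<notin> F xb + C \<Longrightarrow>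
    step F C yb (Loop xb N W) 1 (Normals x (insert w W))"
| finish: "N \<subseteq> W \<Longrightarrow> step F C yb (Loop xb N W) 0 (Return {xb})"

text \<open>\<open>reaches F C yb k c\<close>: some execution is in configuration \<open>c\<close> after having entered
  the loop body \<open>k\<close> times.\<close>

inductive reaches :: "('a \<Rightarrow> 'b::real_inner set) \<Rightarrow> 'b set \<Rightarrow> 'b \<Rightarrow>
    nat \<Rightarrow> ('a, 'b) config \<Rightarrow> bool"
  for F :: "'a \<Rightarrow> 'b set" and C :: "'b set" and yb :: 'b where
  init: "reaches F C yb 0 Start"
| step: "reaches F C yb k c \<Longrightarrow> step F C yb c j c' \<Longrightarrow> reaches F C yb (k + j) c'"

definition infinite_execution ::
    "('a \<Rightarrow> 'b::real_inner set) \<Rightarrow> 'b set \<Rightarrow> 'b \<Rightarrow> (nat \<Rightarrow> ('a, 'b) config) \<Rightarrow> bool" where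
  "infinite_execution F C yb s \<longleftrightarrow>
     s 0 = Start \<and> (\<forall>i. \<exists>j. step F C yb (s i) j (s (Suc i)))"

text \<open>Every execution ends in a \<open>Return\<close> configuration after finitely many steps: none
  is infinite, and none gets stuck elsewhere.\<close>

definition always_returns ::
    "('a \<Rightarrow> 'b::real_inner set) \<Rightarrow> 'b set \<Rightarrow> 'b \<Rightarrow> bool" where
  "always_returns F C yb \<longleftrightarrow>
     (\<nexists>s. infinite_execution F C yb s) \<and>
     (\<forall>k c. reaches F C yb k c \<longrightarrow> (\<exists>R. c = Return R) \<or> (\<exists>j c'. step F C yb c j c'))"

end

theory Submission
  imports Defs
begin

text \<open>The graph of \<open>F\<^sub>C\<close> is a polyhedron, so for a representation by \<open>m\<close> inequalities every value
  \<open>F\<^sub>C x\<close> is described by the same \<open>m\<close> normal directions, with only the right-hand sides depending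
  on \<open>x\<close>. Since a nonempty value has interior points, the members of a minimal system of outer
  normals are facet normals and hence occur among these directions. Every iteration adds a new
  direction to \<open>W\<close>, which gives the bound. Conversely, once \<open>w\<close> has been treated, some point of the
  current value maximizes \<open>w\<close> over all values containing the current one, and this persists because
  the values only grow. When all facet normals have been treated, no value can be strictly
  larger.\<close>

section \<open>Linear images of polyhedra\<close>

lemma polyhedron_iff_finite_halfspaces:
  fixes S :: "'a::euclidean_space set"
  shows "polyhedron S \<longleftrightarrow> (\<exists>H. finite H \<and> S = {x. \<forall>(a, b)\<in>H. a \<bullet> x \<le> b})"
proof
  assume "polyhedron S"
  then obtain \<F> where \<F>: "finite \<F>" "S = \<Inter>\<F>"
    "\<forall>h\<in>\<F>. \<exists>a b. a \<noteq> 0 \<and> h = {x. a \<bullet> x \<le> b}"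
    unfolding polyhedron_def by (elim exE conjE)
  have "\<forall>h\<in>\<F>. \<exists>p. h = {x. fst p \<bullet> x \<le> snd p}"
  proof
    fix h assume "h \<in> \<F>"
    then obtain a b where "h = {x. a \<bullet> x \<le> b}" using \<F>(3) by blast
    then show "\<exists>p. h = {x. fst p \<bullet> x \<le> snd p}" by (intro exI[of _ "(a, b)"]) simp
  qed
  from bchoice[OF this] obtain p where p: "\<forall>h\<in>\<F>. h = {x. fst (p h) \<bullet> x \<le> snd (p h)}" ..
  have "S = {x. \<forall>(a, b)\<in>p ` \<F>. a \<bullet> x \<le> b}"
  proof -
    have "x \<in> h \<longleftrightarrow> fst (p h) \<bullet> x \<le> snd (p h)" if "h \<in> \<F>" for x h
      by (subst bspec[OF p that]) simp
    then show ?thesis using \<F>(2) by (auto simp: split_beta)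
  qed
  then show "\<exists>H. finite H \<and> S = {x. \<forall>(a, b)\<in>H. a \<bullet> x \<le> b}"
    using \<F>(1) by blast
next
  assume "\<exists>H. finite H \<and> S = {x. \<forall>(a, b)\<in>H. a \<bullet> x \<le> b}"
  then obtain H where H: "finite H" "S = {x. \<forall>(a, b)\<in>H. a \<bullet> x \<le> b}" by blast
  have "S = \<Inter> ((\<lambda>(a, b). {x. a \<bullet> x \<le> b}) ` H)"
    using H(2) by auto
  also have "polyhedron \<dots>"
    using H(1) by (intro polyhedron_Inter) (auto simp: polyhedron_halfspace_le)
  finally show "polyhedron S" .
qed

lemma polyhedron_linear_vimage:
  fixes f :: "'a::euclidean_space \<Rightarrow> 'b::euclidean_space"
  assumes "linear f" "polyhedron S"
  shows "polyhedron (f -` S)"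
proof -
  obtain H where H: "finite H" "S = {x. \<forall>(a, b)\<in>H. a \<bullet> x \<le> b}"
    using assms(2) polyhedron_iff_finite_halfspaces by blast
  have "f -` S = {x. \<forall>(a, b)\<in>(\<lambda>(a, b). (adjoint f a, b)) ` H. a \<bullet> x \<le> b}"
    by (auto simp: H(2) adjoint_clauses[OF assms(1)] split_beta)
  moreover have "finite ((\<lambda>(a, b). (adjoint f a, b)) ` H)"
    using H(1) by simp
  ultimately show ?thesis
    unfolding polyhedron_iff_finite_halfspaces by (intro exI conjI)
qed

text \<open>Supplies the value of the eliminated coordinate below: the largest lower bound or, if
  there is none, the smallest upper bound.\<close>

lemma finite_real_separating_point:
  fixes L U :: "real set"
  assumes "finite L" "finite U" "\<And>l u. l \<in> L \<Longrightarrow> u \<in> U \<Longrightarrow> l \<le> u"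
  obtains t where "\<And>l. l \<in> L \<Longrightarrow> l \<le> t" "\<And>u. u \<in> U \<Longrightarrow> t \<le> u"
proof (cases "L = {}")
  case True
  show ?thesis
  proof (cases "U = {}")
    case False
    then show ?thesis using that[of "Min U"] True assms by auto
  qed (use that True in auto)
next
  case False
  then show ?thesis using that[of "Max L"] assms by auto
qed

text \<open>Fourier--Motzkin elimination of the coordinate along \<open>v\<close>.\<close>

lemma polyhedron_sum_line:
  fixes S :: "'a::euclidean_space set"
  assumes "polyhedron S"
  shows "polyhedron {z. \<exists>t. z + t *\<^sub>R v \<in> S}"
proof -
  obtain H where H: "finite H" "S = {x. \<forall>(a, b)\<in>H. a \<bullet> x \<le> b}"
    using assms polyhedron_iff_finite_halfspaces by blast
  define Z where "Z = {h\<in>H. fst h \<bullet> v = 0}"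
  define P where "P = {h\<in>H. fst h \<bullet> v > 0}"
  define N where "N = {h\<in>H. fst h \<bullet> v < 0}"
  \<comment> \<open>The bound that \<open>h\<close> puts on \<open>t\<close> in
    \<open>z + t *\<^sub>R v\<close>: an upper bound for \<open>h\<close> in \<open>P\<close>, a
    lower one for \<open>h\<close> in \<open>N\<close>.\<close>
  define r where "r z h = (snd h - fst h \<bullet> z) / (fst h \<bullet> v)" for z and h :: "'a \<times> real"
  have fin: "finite Z" "finite P" "finite N"
    using H(1) by (auto simp: Z_def P_def N_def)
  have eq: "{z. \<exists>t. z + t *\<^sub>R v \<in> S} =
      (\<Inter>h\<in>Z. {z. fst h \<bullet> z \<le> snd h}) \<inter> (\<Inter>(h, h')\<in>P \<times> N. {z. r z h' \<le> r z h})"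
    (is "_ = ?R")
  proof (intro subset_antisym subsetI)
    fix z assume "z \<in> {z. \<exists>t. z + t *\<^sub>R v \<in> S}"
    then obtain t where "z + t *\<^sub>R v \<in> S" by blast
    then have t: "fst h \<bullet> z + t * (fst h \<bullet> v) \<le> snd h" if "h \<in> H" for h
      using that H(2) by (auto simp: inner_right_distrib split_beta)
    have "fst h \<bullet> z \<le> snd h" if "h \<in> Z" for h
      using t[of h] that by (auto simp: Z_def)
    moreover have "t \<le> r z h" if "h \<in> P" for h
      using t[of h] that by (auto simp: P_def r_def field_simps)
    moreover have "r z h \<le> t" if "h \<in> N" for h
      using t[of h] that by (auto simp: N_def r_def field_simps)
    ultimately show "z \<in> ?R" by fastforce
  next
    fix z assume z: "z \<in> ?R"
    obtain t where t: "\<And>l. l \<in> r z ` N \<Longrightarrow> l \<le> t" "\<And>u. u \<in> r z ` P \<Longrightarrow> t \<le> u"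
      by (rule finite_real_separating_point[of "r z ` N" "r z ` P"]) (use fin z in auto)
    have "fst h \<bullet> z + t * (fst h \<bullet> v) \<le> snd h" if h: "h \<in> H" for h
    proof -
      consider "h \<in> Z" | "h \<in> P" | "h \<in> N"
        using h that
        by (cases "fst h \<bullet> v" "0::real" rule: linorder_cases) (auto simp: Z_def P_def N_def)
      then show ?thesis
      proof cases
        case 1
        then show ?thesis using z by (auto simp: Z_def)
      next
        case 2
        then have "t \<le> r z h" using t by blast
        then show ?thesis using 2 by (auto simp: P_def r_def field_simps)
      next
        case 3
        then have "r z h \<le> t" using t by blast
        then show ?thesis using 3 by (auto simp: N_def r_def field_simps)
      qed
    qed
    then have "z + t *\<^sub>R v \<in> S"
      using H(2) by (auto simp: inner_right_distrib split_beta)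
    then show "z \<in> {z. \<exists>t. z + t *\<^sub>R v \<in> S}" by blast
  qed
  \<comment> \<open>No sign condition is needed: as division by zero yields 0, \<open>r z h\<close>
    is affine in \<open>z\<close> for every \<open>h\<close>.\<close>
  have "polyhedron {z. r z h' \<le> r z h}" for h h'
  proof -
    have "{z. r z h' \<le> r z h} =
      {z. (inverse (fst h \<bullet> v) *\<^sub>R fst h - inverse (fst h' \<bullet> v) *\<^sub>R fst h') \<bullet> z
            \<le> snd h / (fst h \<bullet> v) - snd h' / (fst h' \<bullet> v)}"
      by (auto simp: r_def inner_diff_left diff_divide_distrib divide_inverse algebra_simps)
    then show ?thesis by (simp only: polyhedron_halfspace_le)
  qed
  then show ?thesis
    unfolding eq using fin
    by (intro polyhedron_Int polyhedron_Inter) (auto simp: polyhedron_halfspace_le)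
qed

text \<open>One elimination step for each generator of the subspace.\<close>

lemma polyhedron_sum_span:
  fixes S :: "'a::euclidean_space set"
  assumes "finite B" "polyhedron S"
  shows "polyhedron {z. \<exists>u\<in>span B. z + u \<in> S}"
  using assms(1)
proof (induction B rule: finite_induct)
  case empty
  then show ?case using assms(2) by simp
next
  case (insert v B)
  have eq: "{z. \<exists>u\<in>span (insert v B). z + u \<in> S} =
        {z. \<exists>t. z + t *\<^sub>R v \<in> {z. \<exists>u\<in>span B. z + u \<in> S}}" (is "?L = ?R")
  proof (intro subset_antisym subsetI)
    fix z assume "z \<in> ?L"
    then obtain u k where "z + u \<in> S" "u - k *\<^sub>R v \<in> span B"
      by (auto simp: span_insert)
    then show "z \<in> ?R"
      by (intro CollectI exI[of _ k] bexI[of _ "u - k *\<^sub>R v"]) auto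
  next
    fix z assume "z \<in> ?R"
    then obtain u t where "z + t *\<^sub>R v + u \<in> S" "u \<in> span B" by auto
    then show "z \<in> ?L"
      by (intro CollectI bexI[of _ "t *\<^sub>R v + u"]) (auto simp: span_insert add.assoc intro: exI[of _ t])
  qed
  show ?case unfolding eq by (rule polyhedron_sum_line[OF insert.IH])
qed

text \<open>The image is a projection of \<open>T\<close>, the set of pairs \<open>(f x, x)\<close>
  with \<open>x\<close> in \<open>S\<close>. Projecting means adding the subspace
  \<open>{0} \<times> UNIV\<close> and then cutting at second component 0.\<close>

lemma polyhedron_linear_image:
  fixes f :: "'a::euclidean_space \<Rightarrow> 'b::euclidean_space"
  assumes f: "linear f" and S: "polyhedron S"
  shows "polyhedron (f ` S)"
proof -
  interpret linear f by (rule f)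
  define T where "T = (\<lambda>p. fst p - f (snd p)) -` {0} \<inter> snd -` S"
  have "linear (\<lambda>p::'b \<times> 'a. fst p - f (snd p))"
    by (rule linearI) (simp_all add: add scale scaleR_right_diff_distrib)
  then have T: "polyhedron T"
    unfolding T_def using S
    by (intro polyhedron_Int polyhedron_linear_vimage linear_snd
        affine_imp_polyhedron[OF affine_sing])
  obtain B :: "('b \<times> 'a) set" where B: "finite B" "span B = {0} \<times> UNIV"
  proof -
    have "subspace ({0} \<times> UNIV :: ('b \<times> 'a) set)"
      by (simp add: subspace_Times subspace_0 subspace_UNIV)
    then show ?thesis
      by (metis that basis_subspace_exists span_subspace)
  qed
  have "linear (\<lambda>y::'b. (y, 0::'a))"
    by (rule linearI) auto
  from polyhedron_linear_vimage[OF this polyhedron_sum_span[OF B(1) T]]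
  have "polyhedron ((\<lambda>y. (y, 0)) -` {z. \<exists>u\<in>{0} \<times> UNIV. z + u \<in> T})"
    unfolding B(2) .
  also have "(\<lambda>y. (y, 0)) -` {z. \<exists>u\<in>{0} \<times> UNIV. z + u \<in> T} = f ` S"
    by (auto simp: T_def)
  finally show ?thesis .
qed

lemma polyhedron_set_plus:
  fixes S T :: "'a::euclidean_space set"
  assumes "polyhedron S" "polyhedron T"
  shows "polyhedron (S + T)"
proof -
  have "polyhedron (fst -` S \<inter> snd -` T)"
    using assms by (intro polyhedron_Int polyhedron_linear_vimage linear_fst linear_snd)
  moreover have "linear (\<lambda>p::'a \<times> 'a. fst p + snd p)"
    by (rule linearI) (auto simp: scaleR_right_distrib)
  moreover have "S + T = (\<lambda>p. fst p + snd p) ` (fst -` S \<inter> snd -` T)"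
    by (auto simp: set_plus_def image_def Bex_def)
  ultimately show ?thesis using polyhedron_linear_image by metis
qed

text \<open>Adding \<open>C\<close> to every value amounts to adding the polyhedron
  \<open>{0} \<times> C\<close> to the graph.\<close>

lemma polyhedron_gr_add_cone:
  fixes F :: "'a::euclidean_space \<Rightarrow> 'b::euclidean_space set"
  assumes "polyhedral_convex_map F" "polyhedron C"
  shows "polyhedron (gr (add_cone F C))"
proof -
  have "gr (add_cone F C) = gr F + (fst -` {0} \<inter> snd -` C)"
    by (auto simp: gr_def add_cone_def set_plus_def Bex_def)
  moreover have "polyhedron (fst -` {0} \<inter> snd -` C :: ('a \<times> 'b) set)"
    using assms(2)
    by (intro polyhedron_Int polyhedron_linear_vimage linear_fst linear_snd
        affine_imp_polyhedron[OF affine_sing])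
  ultimately show ?thesis
    using assms(1) polyhedron_set_plus unfolding polyhedral_convex_map_def by metis
qed

section \<open>Minimal inequality representations\<close>

lemma polyhedron_imp_ineq_rep:
  fixes Q :: "'a::euclidean_space set"
  assumes "polyhedron Q"
  shows "\<exists>k w \<gamma>. ineq_rep k w \<gamma> Q"
proof -
  obtain H where H: "finite H" "Q = {x. \<forall>(a, b)\<in>H. a \<bullet> x \<le> b}"
    using assms polyhedron_iff_finite_halfspaces by blast
  obtain n and h :: "nat \<Rightarrow> 'a \<times> real" where "H = h ` {i. i < n}"
    using finite_imp_nat_seg_image_inj_on[OF H(1)] by blast
  then have "ineq_rep n (fst \<circ> h) (snd \<circ> h) Q"
    by (auto simp: ineq_rep_def H(2) inner_commute split_beta)
  then show ?thesis by blast
qed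

lemma polyhedron_imp_min_ineq_number:
  fixes Q :: "'a::euclidean_space set"
  assumes "polyhedron Q"
  shows "\<exists>m. min_ineq_number Q m"
proof -
  let ?P = "\<lambda>k. \<exists>w \<gamma>. ineq_rep k w \<gamma> Q"
  have "?P (LEAST k. ?P k)"
    using polyhedron_imp_ineq_rep[OF assms] by (rule LeastI_ex[of ?P])
  moreover have "(LEAST k. ?P k) \<le> k" if "ineq_rep k w \<gamma> Q" for k w \<gamma>
    using that by (intro Least_le[of ?P]) blast
  ultimately show ?thesis unfolding min_ineq_number_def by blast
qed

text \<open>Nonemptiness of \<open>Q\<close> allows the inequalities with zero normal to be dropped.\<close>

lemma ineq_rep_imp_unit_ineq_rep:
  fixes Q :: "'a::real_inner set"
  assumes Q: "ineq_rep m u \<beta> Q" and ne: "Q \<noteq> {}"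
  shows "\<exists>k w \<gamma>. unit_ineq_rep k w \<gamma> Q"
proof -
  obtain n and h :: "nat \<Rightarrow> nat" where h: "{i. i < m \<and> u i \<noteq> 0} = h ` {i. i < n}"
    using finite_imp_nat_seg_image_inj_on[of "{i. i < m \<and> u i \<noteq> 0}"] by auto
  have Q': "Q = {y. \<forall>i<m. y \<bullet> u i \<le> \<beta> i}"
    using Q by (simp add: ineq_rep_def)
  have zero: "0 \<le> \<beta> i" if "i < m" "u i = 0" for i
    using ne that unfolding Q' by fastforce
  have "Q = {y. \<forall>i\<in>{i. i < m \<and> u i \<noteq> 0}. y \<bullet> u i \<le> \<beta> i}"
    unfolding Q' using zero by force
  also have "\<dots> = {y. \<forall>i<n. y \<bullet> sgn (u (h i)) \<le> \<beta> (h i) / norm (u (h i))}"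
  proof -
    have "y \<bullet> sgn (u i) \<le> \<beta> i / norm (u i) \<longleftrightarrow> y \<bullet> u i \<le> \<beta> i" if "u i \<noteq> 0" for y i
      using that by (simp add: sgn_div_norm field_simps)
    then show ?thesis
      unfolding h using h by blast
  qed
  finally have "ineq_rep n (\<lambda>i. sgn (u (h i))) (\<lambda>i. \<beta> (h i) / norm (u (h i))) Q"
    unfolding ineq_rep_def .
  moreover have "\<forall>i<n. norm (sgn (u (h i))) = 1"
    using h by (auto simp: norm_sgn)
  ultimately show ?thesis unfolding unit_ineq_rep_def by blast
qed

lemma ineq_rep_imp_minimal_outer_normals:
  fixes Q :: "'a::real_inner set"
  assumes "ineq_rep m u \<beta> Q" and "Q \<noteq> {}"
  shows "\<exists>N. minimal_outer_normals Q N"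
proof -
  let ?P = "\<lambda>k. \<exists>w \<gamma>. unit_ineq_rep k w \<gamma> Q"
  have "?P (LEAST k. ?P k)"
    using ineq_rep_imp_unit_ineq_rep[OF assms] by (rule LeastI_ex[of ?P])
  moreover have "(LEAST k. ?P k) \<le> k" if "unit_ineq_rep k w \<gamma> Q" for k w \<gamma>
    using that by (intro Least_le[of ?P]) blast
  ultimately show ?thesis unfolding minimal_outer_normals_def by blast
qed

text \<open>Lets minimality of a unit representation rule out redundant inequalities.\<close>

lemma unit_ineq_rep_drop:
  assumes w: "unit_ineq_rep k w \<gamma> Q" and j: "j < k"
    and red: "Q = {y. \<forall>i<k. i \<noteq> j \<longrightarrow> y \<bullet> w i \<le> \<gamma> i}"
  shows "\<exists>w' \<gamma>'. unit_ineq_rep (k - 1) w' \<gamma>' Q"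
proof -
  \<comment> \<open>\<open>f\<close> enumerates the indices below \<open>k\<close> while skipping
    \<open>j\<close>.\<close>
  define f where "f i = (if i < j then i else Suc i)" for i
  have f: "{i. i < k \<and> i \<noteq> j} = f ` {..<k - 1}"
  proof (intro subset_antisym subsetI)
    fix i assume "i \<in> {i. i < k \<and> i \<noteq> j}"
    then have "i = f (if i < j then i else i - 1)" "(if i < j then i else i - 1) < k - 1"
      using j by (auto simp: f_def)
    then show "i \<in> f ` {..<k - 1}" by blast
  qed (use j in \<open>auto simp: f_def split: if_splits\<close>)
  have "Q = {y. \<forall>i\<in>f ` {..<k - 1}. y \<bullet> w i \<le> \<gamma> i}"
    unfolding f[symmetric] by (subst red) auto
  moreover have "\<forall>i\<in>f ` {..<k - 1}. norm (w i) = 1"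
    using w unfolding f[symmetric] by (simp add: unit_ineq_rep_def)
  ultimately have "unit_ineq_rep (k - 1) (w \<circ> f) (\<gamma> \<circ> f) Q"
    unfolding unit_ineq_rep_def ineq_rep_def by auto
  then show ?thesis by blast
qed

section \<open>Facet normals of polyhedra with interior points\<close>

text \<open>A ball around \<open>p\<close> inside \<open>Q\<close> allows a step along
  \<open>w\<close>, which strictly increases the left-hand side.\<close>

lemma interior_imp_strict_ineq:
  fixes Q :: "'a::real_inner set"
  assumes p: "p \<in> interior Q" and Q: "\<And>y. y \<in> Q \<Longrightarrow> y \<bullet> w \<le> \<gamma>" and w: "w \<noteq> 0"
  shows "p \<bullet> w < \<gamma>"
proof -
  obtain e where e: "e > 0" "cball p e \<subseteq> Q"
    using p mem_interior_cball by blast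
  have "p + e *\<^sub>R sgn w \<in> Q"
    using e w by (intro subsetD[OF e(2)]) (simp add: dist_norm norm_sgn)
  from Q[OF this] have "p \<bullet> w + e * norm w \<le> \<gamma>"
    using w by (simp add: inner_left_distrib sgn_div_norm dot_square_norm power2_eq_square field_simps)
  moreover have "e * norm w > 0" using e w by simp
  ultimately show ?thesis by linarith
qed

text \<open>Inactive inequalities survive short moves by continuity, active ones because
  \<open>d\<close> does not increase them. As there are finitely many, one step length serves
  all.\<close>

lemma small_move_satisfies_ineqs:
  fixes q d :: "'a::real_inner" and k :: nat
  assumes "\<And>i. i < k \<Longrightarrow> q \<bullet> w i < \<gamma> i \<or> (q \<bullet> w i = \<gamma> i \<and> d \<bullet> w i \<le> 0)"
  shows "\<exists>e>0. \<forall>i<k. (q + e *\<^sub>R d) \<bullet> w i \<le> \<gamma> i"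
proof -
  have "\<forall>\<^sub>F e in at_right 0. (q + e *\<^sub>R d) \<bullet> w i \<le> \<gamma> i" if "i < k" for i
    using assms[OF that]
  proof
    assume "q \<bullet> w i < \<gamma> i"
    moreover have "((\<lambda>e. (q + e *\<^sub>R d) \<bullet> w i) \<longlongrightarrow> (q + 0 *\<^sub>R d) \<bullet> w i) (at_right 0)"
      by (intro tendsto_intros)
    ultimately have "\<forall>\<^sub>F e in at_right 0. (q + e *\<^sub>R d) \<bullet> w i < \<gamma> i"
      by (intro order_tendstoD(2)) auto
    then show ?thesis by (rule eventually_mono) simp
  next
    assume *: "q \<bullet> w i = \<gamma> i \<and> d \<bullet> w i \<le> 0"
    have "\<forall>\<^sub>F e in at_right 0. e > (0::real)"
      by (rule eventually_at_right_less)
    then show ?thesis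
      by (rule eventually_mono) (use * in \<open>simp add: inner_left_distrib mult_nonneg_nonpos\<close>)
  qed
  then have "\<forall>\<^sub>F e in at_right 0. \<forall>i\<in>{..<k}. (q + e *\<^sub>R d) \<bullet> w i \<le> \<gamma> i"
    by (intro eventually_ball_finite) auto
  moreover have "\<forall>\<^sub>F e in at_right 0. e > (0::real)"
    by (rule eventually_at_right_less)
  ultimately have "\<forall>\<^sub>F e in at_right 0. e > (0::real) \<and> (\<forall>i<k. (q + e *\<^sub>R d) \<bullet> w i \<le> \<gamma> i)"
    by eventually_elim auto
  then show ?thesis
    using eventually_happens'[OF trivial_limit_at_right_real] by blast
qed

text \<open>By minimality, each \<open>w j\<close> has a point \<open>q\<close> of \<open>Q\<close>
  at which only the \<open>j\<close>-th inequality is active, so near \<open>q\<close> the set is a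
  half-space with outer normal \<open>w j\<close>. Any representation of \<open>Q\<close> must then
  contain an inequality active at \<open>q\<close> whose normal is a positive multiple of
  \<open>w j\<close>. Normalization by \<open>sgn\<close> is required because the \<open>u i\<close>
  have arbitrary length.\<close>

lemma minimal_outer_normals_subset:
  fixes Q :: "'a::real_inner set"
  assumes N: "minimal_outer_normals Q N" and int: "interior Q \<noteq> {}"
    and rep: "ineq_rep m u \<beta> Q"
  shows "N \<subseteq> sgn ` u ` {..<m}"
proof -
  obtain k w \<gamma> where w: "unit_ineq_rep k w \<gamma> Q" "N = w ` {..<k}"
    and least: "\<And>k' w' \<gamma>'. unit_ineq_rep k' w' \<gamma>' Q \<Longrightarrow> k \<le> k'"
    using N unfolding minimal_outer_normals_def by blast
  have Qw: "Q = {y. \<forall>i<k. y \<bullet> w i \<le> \<gamma> i}" and unit: "\<And>i. i < k \<Longrightarrow> norm (w i) = 1"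
    using w(1) by (auto simp: unit_ineq_rep_def ineq_rep_def)
  have Qu: "Q = {y. \<forall>i<m. y \<bullet> u i \<le> \<beta> i}"
    using rep by (simp add: ineq_rep_def)
  obtain p where "p \<in> interior Q" using int by blast
  have p: "p \<bullet> w i < \<gamma> i" if "i < k" for i
    by (rule interior_imp_strict_ineq[OF \<open>p \<in> interior Q\<close>]) (use Qw unit[OF that] that in auto)
  have "w j \<in> sgn ` u ` {..<m}" if j: "j < k" for j
  proof -
    have "Q \<noteq> {y. \<forall>i<k. i \<noteq> j \<longrightarrow> y \<bullet> w i \<le> \<gamma> i}"
    proof
      assume "Q = {y. \<forall>i<k. i \<noteq> j \<longrightarrow> y \<bullet> w i \<le> \<gamma> i}"
      then obtain w' \<gamma>' where "unit_ineq_rep (k - 1) w' \<gamma>' Q"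
        using unit_ineq_rep_drop[OF w(1) j] by blast
      then show False using least[of "k - 1"] j by force
    qed
    then obtain z where z: "\<And>i. i < k \<Longrightarrow> i \<noteq> j \<Longrightarrow> z \<bullet> w i \<le> \<gamma> i" and zj: "z \<bullet> w j > \<gamma> j"
      unfolding Qw by (force simp: not_le)
    \<comment> \<open>\<open>q\<close> is the point of the segment from \<open>p\<close> to \<open>z\<close> on the \<open>j\<close>-th hyperplane; only the
      \<open>j\<close>-th inequality is active there.\<close>
    define t where "t = (\<gamma> j - p \<bullet> w j) / (z \<bullet> w j - p \<bullet> w j)"
    define q where "q = (1 - t) *\<^sub>R p + t *\<^sub>R z"
    have t: "0 < t" "t < 1" using p[OF j] zj by (auto simp: t_def field_simps)
    have qj: "q \<bullet> w j = \<gamma> j"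
    proof -
      have "q \<bullet> w j = p \<bullet> w j + t * (z \<bullet> w j - p \<bullet> w j)"
        by (simp add: q_def inner_left_distrib algebra_simps)
      then show ?thesis using p[OF j] zj by (simp add: t_def)
    qed
    have qi: "q \<bullet> w i < \<gamma> i" if "i < k" "i \<noteq> j" for i
    proof -
      have "q \<bullet> w i = (1 - t) * (p \<bullet> w i) + t * (z \<bullet> w i)"
        by (simp add: q_def inner_left_distrib)
      also have "\<dots> < (1 - t) * \<gamma> i + t * \<gamma> i"
        using t p[OF that(1)] z[OF that] by (intro add_less_le_mono mult_left_mono) auto
      finally show ?thesis by (simp add: algebra_simps)
    qed
    have qQ: "q \<in> Q" unfolding Qw using qi qj by (force intro: less_imp_le)
    have move: "\<exists>e>0. q + e *\<^sub>R d \<in> Q" if "d \<bullet> w j \<le> 0" for d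
      using small_move_satisfies_ineqs[of k q w \<gamma> d] qi qj that unfolding Qw by blast
    \<comment> \<open>Otherwise a short move from \<open>q\<close> along \<open>w j\<close> would
      stay in \<open>Q\<close> and violate the \<open>j\<close>-th inequality.\<close>
    have "\<exists>i<m. q \<bullet> u i = \<beta> i \<and> w j \<bullet> u i > 0"
    proof (rule ccontr)
      assume none: "\<not> ?thesis"
      then have "q \<bullet> u i < \<beta> i \<or> (q \<bullet> u i = \<beta> i \<and> w j \<bullet> u i \<le> 0)" if "i < m" for i
        using that none qQ unfolding Qu by force
      then obtain e where "e > 0" "\<forall>i<m. (q + e *\<^sub>R w j) \<bullet> u i \<le> \<beta> i"
        using small_move_satisfies_ineqs[of m q u \<beta> "w j"] by blast
      then have "q + e *\<^sub>R w j \<in> Q" using Qu by blast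
      then have "(q + e *\<^sub>R w j) \<bullet> w j \<le> \<gamma> j" using j unfolding Qw by blast
      then show False
        using qj unit[OF j] \<open>e > 0\<close> by (simp add: inner_left_distrib dot_square_norm)
    qed
    then obtain i where i: "i < m" "q \<bullet> u i = \<beta> i" "w j \<bullet> u i > 0" by blast
    define s where "s = w j \<bullet> u i"
    \<comment> \<open>The component of \<open>u i\<close> orthogonal to \<open>w j\<close>. A short
      move along \<open>d\<close> stays in \<open>Q\<close>, but \<open>u i\<close> is active at
      \<open>q\<close> and grows at rate \<open>d \<bullet> d\<close>, which forces
      \<open>d = 0\<close>.\<close>
    define d where "d = u i - s *\<^sub>R w j"
    have dw: "d \<bullet> w j = 0"
      using unit[OF j]
      by (simp add: d_def s_def inner_diff_left dot_square_norm inner_commute[of "w j" "u i"])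
    then obtain e where "e > 0" "q + e *\<^sub>R d \<in> Q" using move[of d] by auto
    then have "e * (d \<bullet> u i) \<le> 0"
      using i unfolding Qu by (auto simp: inner_left_distrib)
    then have "d \<bullet> u i \<le> 0" using \<open>e > 0\<close> by (simp add: mult_le_0_iff)
    moreover have "d \<bullet> u i = d \<bullet> d"
      using dw by (simp add: d_def inner_diff_right inner_diff_left)
    ultimately have "d = 0" by (metis inner_gt_zero_iff not_le)
    then have "u i = s *\<^sub>R w j" by (simp add: d_def)
    moreover have "s > 0" using i by (simp add: s_def)
    ultimately have "sgn (u i) = w j"
      using unit[OF j] by (simp add: sgn_scaleR sgn_div_norm)
    then show ?thesis using i(1) by (metis imageI lessThan_iff)
  qed
  then show ?thesis using w(2) by blast
qed

section \<open>The procedure\<close>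

lemma ineq_rep_gr_value:
  assumes "ineq_rep m v \<gamma> (gr (add_cone F C))"
  shows "ineq_rep m (snd \<circ> v) (\<lambda>i. \<gamma> i - x \<bullet> fst (v i)) (F x + C)"
proof -
  have "F x + C = {y. (x, y) \<in> gr (add_cone F C)}"
    by (simp add: gr_def add_cone_def)
  also have "\<dots> = {y. \<forall>i<m. y \<bullet> snd (v i) \<le> \<gamma> i - x \<bullet> fst (v i)}"
    using assms by (auto simp: ineq_rep_def inner_prod_def algebra_simps)
  finally show ?thesis by (simp add: ineq_rep_def)
qed

text \<open>With \<open>C\<close> as \<open>B\<close>, this gives every nonempty value interior
  points, so that its minimal normals are facet normals.\<close>

lemma interior_set_plus_nonempty:
  fixes A B :: "'a::real_normed_vector set"
  assumes "A \<noteq> {}" "interior B \<noteq> {}"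
  shows "interior (A + B) \<noteq> {}"
proof -
  obtain a where "a \<in> A" using assms(1) by blast
  then have "(+) a ` interior B \<subseteq> A + B"
    using interior_subset by (force simp: set_plus_def)
  then have "(+) a ` interior B \<subseteq> interior (A + B)"
    by (intro interior_maximal) (auto intro: open_translation)
  then show ?thesis using assms(2) by blast
qed

section \<open>Directions that have been treated\<close>

text \<open>Equivalently, the linear program for \<open>w\<close> and \<open>x\<close> has an
  optimal solution whose first component is \<open>x\<close> itself.\<close>

definition maximized_at where
  "maximized_at F C x w \<longleftrightarrow> (\<exists>y\<in>F x + C. \<forall>p\<in>LP_feasible F C x. w \<bullet> snd p \<le> w \<bullet> y)"

lemma LP_feasible_antimono:
  assumes "F x + C \<subseteq> F x' + C"
  shows "LP_feasible F C x' \<subseteq> LP_feasible F C x"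
  using assms unfolding LP_feasible_def by blast

text \<open>For the transition \<open>replace\<close>: passing to \<open>fst p\<close> enlarges the
  value and so shrinks the feasible set, while \<open>p\<close> stays feasible and hence
  optimal.\<close>

lemma LP_optimal_maximized_at:
  assumes "LP_optimal F C w x p"
  shows "maximized_at F C (fst p) w"
proof -
  have p: "snd p \<in> F (fst p) + C" "F x + C \<subseteq> F (fst p) + C"
    using assms by (auto simp: LP_optimal_def LP_feasible_def)
  from p(1) LP_feasible_antimono[of F x C "fst p", OF p(2)] show ?thesis
    using assms unfolding maximized_at_def LP_optimal_def by blast
qed

lemma LP_optimal_maximized_at_self:
  assumes "LP_optimal F C w x p" "snd p \<in> F x + C"
  shows "maximized_at F C x w"
  using assms unfolding maximized_at_def LP_optimal_def by blast

text \<open>The maximizing point remains in the larger value and has fewer competitors.\<close>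

lemma maximized_at_mono:
  assumes "maximized_at F C x w" "F x + C \<subseteq> F x' + C"
  shows "maximized_at F C x' w"
  using assms LP_feasible_antimono[of F x C x', OF assms(2)] unfolding maximized_at_def by blast

text \<open>Every point of a value containing \<open>F x + C\<close> is feasible for the program at
  \<open>x\<close>. The maximum for each \<open>w i\<close> is attained inside
  \<open>F x + C\<close>, so such a point satisfies all inequalities describing
  \<open>F x + C\<close>.\<close>

lemma minimizer_if_maximized_at_normals:
  assumes N: "minimal_outer_normals (F x + C) N" and ne: "F x + C \<noteq> {}"
    and max: "\<And>w. w \<in> N \<Longrightarrow> maximized_at F C x w"
  shows "minimizer F C x"
proof -
  obtain k w \<gamma> where w: "unit_ineq_rep k w \<gamma> (F x + C)" and N: "N = w ` {..<k}"
    using N unfolding minimal_outer_normals_def by blast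
  have rep: "F x + C = {y. \<forall>i<k. y \<bullet> w i \<le> \<gamma> i}"
    using w by (simp add: unit_ineq_rep_def ineq_rep_def)
  have "F x' + C \<subseteq> F x + C" if "F x + C \<subseteq> F x' + C" for x'
  proof
    fix y assume "y \<in> F x' + C"
    then have feas: "(x', y) \<in> LP_feasible F C x"
      using that by (simp add: LP_feasible_def)
    have "y \<bullet> w i \<le> \<gamma> i" if i: "i < k" for i
    proof -
      obtain y' where y': "y' \<in> F x + C" "w i \<bullet> y \<le> w i \<bullet> y'"
      proof -
        have "maximized_at F C x (w i)" using N i by (intro max) simp
        then obtain y' where y': "y' \<in> F x + C"
          "\<forall>p\<in>LP_feasible F C x. w i \<bullet> snd p \<le> w i \<bullet> y'"
          unfolding maximized_at_def ..
        show ?thesis using that[OF y'(1)] bspec[OF y'(2) feas] by simp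
      qed
      have "y' \<bullet> w i \<le> \<gamma> i" using y'(1) i unfolding rep by blast
      then show ?thesis using y'(2) by (simp add: inner_commute)
    qed
    then show "y \<in> F x + C" unfolding rep by blast
  qed
  moreover have "x \<in> Dom F" using ne by (auto simp: Dom_def set_plus_def)
  ultimately show ?thesis unfolding minimizer_def by (metis less_le_not_le)
qed

section \<open>The invariant of an execution\<close>

text \<open>\<open>D\<close> stands for a finite stock of directions containing all normals that can
  occur. Counting by \<open>card W\<close> is exact because each iteration treats a new direction;
  after \<open>Return\<close>, where \<open>W\<close> is lost, only the bound is kept.\<close>

fun run_invariant where
  "run_invariant F C yb D k Start \<longleftrightarrow> k = 0"
| "run_invariant F C yb D k (Normals x W) \<longleftrightarrow>
     k = card W \<and> W \<subseteq> D \<and> yb \<in> F x + C \<and> (\<forall>w\<in>W. maximized_at F C x w)"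
| "run_invariant F C yb D k (Loop x N W) \<longleftrightarrow>
     k = card W \<and> W \<subseteq> D \<and> yb \<in> F x + C \<and> (\<forall>w\<in>W. maximized_at F C x w) \<and>
     minimal_outer_normals (F x + C) N"
| "run_invariant F C yb D k (Return R) \<longleftrightarrow>
     k \<le> card D \<and> (R = {} \<or> (\<exists>x. R = {x} \<and> minimizer F C x \<and> yb \<in> F x + C))"

lemma run_invariant_step:
  assumes inv: "run_invariant F C yb D k c" and "step F C yb c j c'" and D: "finite D"
    and normals: "\<And>x N. F x + C \<noteq> {} \<Longrightarrow> minimal_outer_normals (F x + C) N \<Longrightarrow> N \<subseteq> D"
  shows "run_invariant F C yb D (k + j) c'"
proof -
  \<comment> \<open>Common to all transitions that enter the loop body: the chosen \<open>w\<close>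
    is new and lies in \<open>D\<close>.\<close>
  have grow: "insert w W \<subseteq> D" "card (insert w W) = k + 1"
    if "run_invariant F C yb D k (Loop x N W)" "w \<in> N - W" for x N W w
  proof -
    have W: "k = card W" "W \<subseteq> D" "yb \<in> F x + C" "minimal_outer_normals (F x + C) N"
      using that(1) by simp_all
    then have "N \<subseteq> D" by (intro normals) auto
    then show "insert w W \<subseteq> D" using W(2) that(2) by blast
    show "card (insert w W) = k + 1"
      using W(1) that(2) finite_subset[OF W(2) D] by simp
  qed
  show ?thesis
    using assms(2)
  proof cases
    case (no_optimum w N W xb)
    note g = grow[OF inv[unfolded no_optimum(1)] no_optimum(4)]
    \<comment> \<open>The iteration returning the empty set is counted although its \<open>w\<close>
      never enters \<open>W\<close>; \<open>insert w W\<close> still fits into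
      \<open>D\<close>.\<close>
    have "k + 1 \<le> card D"
      using card_mono[OF D g(1)] unfolding g(2) .
    then show ?thesis by (simp add: no_optimum)
  next
    case (keep w N W xb x y)
    note inv = inv[unfolded keep(1)]
    have "maximized_at F C xb w"
      using LP_optimal_maximized_at_self[OF keep(5)] keep(6) by simp
    then show ?thesis
      unfolding keep(2,3) using grow[OF inv keep(4)] inv by simp
  next
    case (replace w N W xb x y)
    note inv = inv[unfolded replace(1)]
    have sub: "F xb + C \<subseteq> F x + C"
      using replace(5) by (simp add: LP_optimal_def LP_feasible_def)
    have "maximized_at F C x w"
      using LP_optimal_maximized_at[OF replace(5)] by simp
    \<comment> \<open>Directions treated at \<open>xb\<close> stay treated, since the value only
      grows.\<close>
    moreover have "maximized_at F C x w'" if "w' \<in> W" for w'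
      by (rule maximized_at_mono[of F C xb _ x, OF _ sub]) (use inv that in simp)
    moreover have "yb \<in> F x + C" using inv sub by auto
    ultimately show ?thesis
      unfolding replace(2,3) using grow[OF inv replace(4)] by simp
  next
    case (finish N W xb)
    note inv = inv[unfolded finish(1)]
    have W: "k = card W" "W \<subseteq> D" "yb \<in> F xb + C" "minimal_outer_normals (F xb + C) N"
        "\<forall>w\<in>W. maximized_at F C xb w"
      using inv by simp_all
    have "minimizer F C xb"
      by (rule minimizer_if_maximized_at_normals[of F xb C N]) (use W finish(4) in auto)
    then show ?thesis unfolding finish(2,3) using W(1,3) card_mono[OF D W(2)] by simp
  qed (use inv in auto)
qed

lemma run_invariant_reaches:
  assumes "reaches F C yb k c" and "finite D"
    and "\<And>x N. F x + C \<noteq> {} \<Longrightarrow> minimal_outer_normals (F x + C) N \<Longrightarrow> N \<subseteq> D"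
  shows "run_invariant F C yb D k c"
  using assms(1)
proof induction
  case (step k c j c')
  show ?case by (rule run_invariant_step[OF step.IH step.hyps(2) assms(2,3)])
qed auto

lemma run_invariant_bound:
  assumes "run_invariant F C yb D k c" "finite D"
  shows "k \<le> card D"
  using assms by (cases c) (auto intro: card_mono)

section \<open>Termination and progress\<close>

text \<open>A potential that drops on every transition outside the loop body; entering the body may
  raise it, which the term \<open>3 * j\<close> in \<open>step_rank\<close> absorbs.\<close>

fun config_rank :: "('a, 'b) config \<Rightarrow> nat" where
  "config_rank Start = 3"
| "config_rank (Normals x W) = 2"
| "config_rank (Loop x N W) = 1"
| "config_rank (Return R) = 0"

lemma step_rank:
  "step F C yb c j c' \<Longrightarrow> config_rank c' < config_rank c + 3 * j"
  by (induction rule: step.induct) auto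

text \<open>Summing \<open>step_rank\<close> bounds the number of transitions by the number of loop
  entries, which is bounded by assumption.\<close>

lemma no_infinite_execution:
  assumes bound: "\<And>k c. reaches F C yb k c \<Longrightarrow> k \<le> m"
  shows "\<not> infinite_execution F C yb s"
proof
  assume s: "infinite_execution F C yb s"
  have "\<exists>k. reaches F C yb k (s i) \<and> config_rank (s i) + i \<le> 3 * k + 3" for i
  proof (induction i)
    case 0
    then show ?case using s by (auto simp: infinite_execution_def intro: init)
  next
    case (Suc i)
    then obtain k where k: "reaches F C yb k (s i)" "config_rank (s i) + i \<le> 3 * k + 3" by blast
    obtain j where j: "step F C yb (s i) j (s (Suc i))"
      using s by (auto simp: infinite_execution_def)
    have "config_rank (s (Suc i)) + Suc i \<le> 3 * (k + j) + 3"
      using k(2) step_rank[OF j] by simp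
    then show ?case using reaches.step[OF k(1) j] by blast
  qed
  \<comment> \<open>With at most \<open>m\<close> loop entries, at most \<open>3 * m + 3\<close>
    transitions are possible.\<close>
  from this[of "3 * m + 4"] obtain k where "reaches F C yb k (s (3 * m + 4))" "m < k"
    by force
  then show False using bound by fastforce
qed

text \<open>Only two configurations could be stuck: \<open>Start\<close>, where membership in the
  upper image supplies a starting point, and \<open>Normals\<close>, where \<open>ex\<close> applies
  because the invariant puts \<open>yb\<close> into the value.\<close>

lemma run_progress:
  assumes inv: "run_invariant F C yb D k c" and yb: "yb \<in> upper_image F C"
    and ex: "\<And>x. F x + C \<noteq> {} \<Longrightarrow> \<exists>N. minimal_outer_normals (F x + C) N"
  shows "(\<exists>R. c = Return R) \<or> (\<exists>j c'. step F C yb c j c')"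
proof (cases c)
  case Start
  obtain x where "yb \<in> F x + C"
    using yb by (auto simp: upper_image_def set_plus_def) (metis add.commute)
  then have "step F C yb Start 0 (Normals x {})" by (rule choose_start)
  then show ?thesis unfolding Start by blast
next
  case (Normals x W)
  then have "F x + C \<noteq> {}" using inv by auto
  then obtain N where "minimal_outer_normals (F x + C) N" using ex by blast
  then have "step F C yb (Normals x W) 0 (Loop x N W)" by (rule compute_normals)
  then show ?thesis unfolding Normals by blast
next
  case (Loop x N W)
  show ?thesis
  proof (cases "N \<subseteq> W")
    case True
    then have "step F C yb (Loop x N W) 0 (Return {x})" by (rule finish)
    then show ?thesis unfolding Loop by blast
  next
    case False
    then obtain w where w: "w \<in> N - W" by blast
    show ?thesis
    proof (cases "\<exists>p. LP_optimal F C w x p")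
      case True
      then obtain x' y' where opt: "LP_optimal F C w x (x', y')" by auto
      have "step F C yb (Loop x N W) 1
          (if y' \<in> F x + C then Loop x N (insert w W) else Normals x' (insert w W))"
        using keep[OF w opt] replace[OF w opt] by simp
      then show ?thesis unfolding Loop by blast
    next
      case False
      then have "step F C yb (Loop x N W) 1 (Return {})" by (rule no_optimum[OF w])
      then show ?thesis unfolding Loop by blast
    qed
  qed
qed auto

theorem proposition3p2:
  fixes F :: "real ^ 'n \<Rightarrow> (real ^ 'q) set"
    and C :: "(real ^ 'q) set"
    and yb :: "real ^ 'q"
  assumes "polyhedral_convex_map F"
    and "polyhedron C" and "convex_cone C" and "interior C \<noteq> {}"
    and "yb \<in> upper_image F C"
  shows "always_returns F C yb \<and>
    (\<forall>k R. reaches F C yb k (Return R) \<longrightarrow>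
       R = {} \<or> (\<exists>xb. R = {xb} \<and> minimizer F C xb \<and> yb \<in> F xb + C)) \<and>
    (\<exists>m. min_ineq_number (gr (add_cone F C)) m \<and>
       (\<forall>k c. reaches F C yb k c \<longrightarrow> k \<le> m))"
proof -
  obtain m where m: "min_ineq_number (gr (add_cone F C)) m"
    using polyhedron_imp_min_ineq_number[OF polyhedron_gr_add_cone[OF assms(1,2)]] by blast
  then obtain v \<gamma> where v: "ineq_rep m v \<gamma> (gr (add_cone F C))"
    unfolding min_ineq_number_def by blast
  \<comment> \<open>The normalized output parts of the \<open>m\<close> graph inequalities: at most
    \<open>m\<close> directions, the same for every \<open>x\<close>.\<close>
  define D where "D = sgn ` (snd \<circ> v) ` {..<m}"
  have D: "finite D" "card D \<le> m"
    unfolding D_def using card_image_le[of "{..<m}" "sgn \<circ> (snd \<circ> v)"]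
    by (simp_all add: image_comp)
  have normals: "N \<subseteq> D" if "F x + C \<noteq> {}" "minimal_outer_normals (F x + C) N" for x N
  proof -
    have "F x \<noteq> {}" using that(1) by (auto simp: set_plus_def)
    then have "interior (F x + C) \<noteq> {}" using assms(4) by (rule interior_set_plus_nonempty)
    then show ?thesis
      unfolding D_def by (rule minimal_outer_normals_subset[OF that(2) _ ineq_rep_gr_value[OF v]])
  qed
  have inv: "run_invariant F C yb D k c" if "reaches F C yb k c" for k c
    using that D(1) normals by (rule run_invariant_reaches)
  have bound: "k \<le> m" if "reaches F C yb k c" for k c
    using run_invariant_bound[OF inv[OF that] D(1)] D(2) by simp
  have "always_returns F C yb"
    unfolding always_returns_def
  proof (intro conjI allI impI notI)
    assume "\<exists>s. infinite_execution F C yb s"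
    then obtain s where "infinite_execution F C yb s" ..
    moreover have "\<not> infinite_execution F C yb s"
      by (rule no_infinite_execution) (rule bound)
    ultimately show False by contradiction
  next
    fix k c assume "reaches F C yb k c"
    then show "(\<exists>R. c = Return R) \<or> (\<exists>j c'. step F C yb c j c')"
      by (rule run_progress[OF inv assms(5)
            ineq_rep_imp_minimal_outer_normals[OF ineq_rep_gr_value[OF v]]])
  qed
  moreover have "R = {} \<or> (\<exists>xb. R = {xb} \<and> minimizer F C xb \<and> yb \<in> F xb + C)"
    if "reaches F C yb k (Return R)" for k R
    using inv[OF that] by simp
  ultimately show ?thesis using m bound by blast
qed

end
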